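(* For every $n\in\mathbb N$ (positive integer) there exists a continuous cubes preserving function $f_n$ from $[0,1]$ onto $[0,1]^n$.
   Context: For $n\ge 1$ and $s\ge 0$, $K^n_s$ denotes the set of the $2^{ns}$ closed dyadic subcubes of $[0,1]^n$ of side $2^{-s}$: $K^n_0=\{[0,1]^n\}$, and $K^n_s$ is obtained by dividing each cube of $K^n_{s-1}$ into $2^n$ closed congruent cubes of side $2^{-s}$. In particular $K^1_{ns}$ is the set of closed dyadic subintervals of $[0,1]$ of length $2^{-ns}$. A function $f:[0,1]\to[0,1]^n$ is called cubes preserving if for every $s\in\mathbb N$: (i) for every $\alpha\in K^1_{ns}$ there is $\delta\in K^n_s$ with $f(\alpha)\subseteq\delta$; and (ii) for every $\delta\in K^n_s$ there is $\alpha\in K^1_{ns}$ with $f^{-1}(\operatorname{int}(\delta))\subseteq\alpha$, where $\operatorname{int}(\delta)$ is the set of interior points of $\delta$. *)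

theory Defs
  imports "HOL-Analysis.Analysis"
begin

text \<open>The family is defined over an arbitrary Euclidean space, so that the same constant gives
  the cubes of the unit cube in \<^typ>\<open>real^'n\<close> and the intervals of the unit interval in \<^typ>\<open>real\<close>.\<close>

definition dyadic_cube :: "nat \<Rightarrow> ('a::euclidean_space \<Rightarrow> nat) \<Rightarrow> 'a set" where
  "dyadic_cube s k =
     cbox (\<Sum>b\<in>Basis. (real (k b) / 2 ^ s) *\<^sub>R b) (\<Sum>b\<in>Basis. (real (k b + 1) / 2 ^ s) *\<^sub>R b)"

definition dyadic_cubes :: "nat \<Rightarrow> 'a::euclidean_space set set" where
  "dyadic_cubes s = {dyadic_cube s k | k. \<forall>b\<in>Basis. k b < 2 ^ s}"

text \<open>Functions on the unit interval are total functions on \<^typ>\<open>real\<close> whose values outside the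
  interval are irrelevant; the preimage in the last clause is therefore taken within the interval.
  Interiors are taken in the whole space \<^typ>\<open>real^'n\<close>, not relative to the unit cube.\<close>

definition cubes_preserving :: "(real \<Rightarrow> real^'n) \<Rightarrow> bool" where
  "cubes_preserving f \<longleftrightarrow>
     f ` {0..1} \<subseteq> {x. \<forall>i. 0 \<le> x $ i \<and> x $ i \<le> 1} \<and>
     (\<forall>s.
       (\<forall>\<alpha>\<in>dyadic_cubes (CARD('n) * s). \<exists>\<delta>\<in>dyadic_cubes s. f ` \<alpha> \<subseteq> \<delta>) \<and>
       (\<forall>\<delta>\<in>dyadic_cubes s. \<exists>\<alpha>\<in>dyadic_cubes (CARD('n) * s).
          {t\<in>{0..1}. f t \<in> interior \<delta>} \<subseteq> \<alpha>))"

lemma mem_dyadic_cube: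
  "x \<in> dyadic_cube s k \<longleftrightarrow>
     (\<forall>b\<in>Basis. real (k b) / 2 ^ s \<le> x \<bullet> b \<and> x \<bullet> b \<le> real (k b + 1) / 2 ^ s)"
  by (simp add: dyadic_cube_def mem_box)

lemma dyadic_cubes_real:
  "dyadic_cubes s = {{real k / 2 ^ s .. real (k + 1) / 2 ^ s} | k. k < 2 ^ s}" (is "_ = ?R")
proof -
  have *: "dyadic_cube s k = {real (k 1) / 2 ^ s .. real (k 1 + 1) / 2 ^ s}" for k :: "real \<Rightarrow> nat"
    by (auto simp: dyadic_cube_def)
  show ?thesis
  proof (intro equalityI subsetI)
    fix Q assume "Q \<in> ?R"
    then obtain k where "k < 2 ^ s" "Q = {real k / 2 ^ s .. real (k + 1) / 2 ^ s}"
      by blast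
    then show "Q \<in> dyadic_cubes s"
      unfolding dyadic_cubes_def * by (intro CollectI exI[of _ "\<lambda>_. k"]) simp
  qed (unfold dyadic_cubes_def *, auto)
qed

lemma dyadic_cubes_vec:
  "dyadic_cubes s =
     {{x :: real^'n. \<forall>i. real (k i) / 2 ^ s \<le> x $ i \<and> x $ i \<le> real (k i + 1) / 2 ^ s} | k.
        \<forall>i. k i < 2 ^ s}" (is "_ = ?R")
proof -
  have *: "dyadic_cube s k =
      {x :: real^'n. \<forall>i. real (k (axis i 1)) / 2 ^ s \<le> x $ i \<and> x $ i \<le> real (k (axis i 1) + 1) / 2 ^ s}" for k
    by (auto simp: mem_dyadic_cube Basis_vec_def inner_axis set_eq_iff)
  show ?thesis
  proof (intro equalityI subsetI)
    fix Q :: "(real^'n) set" assume "Q \<in> dyadic_cubes s"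
    then obtain k where "Q = dyadic_cube s k" "\<forall>b\<in>Basis. k b < 2 ^ s"
      by (auto simp: dyadic_cubes_def)
    then show "Q \<in> ?R"
      unfolding * by (intro CollectI exI[of _ "\<lambda>i. k (axis i 1)"]) (auto simp: Basis_vec_def)
  next
    fix Q assume "Q \<in> ?R"
    then obtain k where k: "\<forall>i. k i < 2 ^ s"
      and Q: "Q = {x :: real^'n. \<forall>i. real (k i) / 2 ^ s \<le> x $ i \<and> x $ i \<le> real (k i + 1) / 2 ^ s}"
      by auto
    define l where "l b = k (THE i. b = axis i (1::real))" for b
    have l: "l (axis i 1) = k i" for i
      by (simp add: l_def axis_eq_axis)
    show "Q \<in> dyadic_cubes s"
      unfolding dyadic_cubes_def
      by (intro CollectI exI[of _ l]) (use k in \<open>auto simp: * l Q Basis_vec_def\<close>)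
  qed
qed

lemma dyadic_cubes_0: "dyadic_cubes 0 = {cbox 0 One :: 'a::euclidean_space set}"
proof -
  have *: "dyadic_cube 0 k = cbox 0 One" if "\<forall>b\<in>Basis. k b < 2 ^ 0" for k :: "'a \<Rightarrow> nat"
    using that by (simp add: dyadic_cube_def)
  show ?thesis
  proof (intro equalityI subsetI)
    fix Q :: "'a set" assume "Q \<in> dyadic_cubes 0"
    then show "Q \<in> {cbox 0 One}"
      unfolding dyadic_cubes_def using * by blast
  next
    fix Q :: "'a set" assume "Q \<in> {cbox 0 One}"
    then show "Q \<in> dyadic_cubes 0"
      unfolding dyadic_cubes_def using *[of "\<lambda>_. 0"] by (intro CollectI exI[of _ "\<lambda>_. 0"]) simp
  qed
qed

lemma dyadic_cube_eq_iff:
  "dyadic_cube s k = dyadic_cube s l \<longleftrightarrow> (\<forall>b\<in>Basis. k b = l b)"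
proof
  assume eq: "dyadic_cube s k = dyadic_cube s l"
  define p :: "('a \<Rightarrow> nat) \<Rightarrow> 'a" where "p m = (\<Sum>b\<in>Basis. (real (m b) / 2 ^ s) *\<^sub>R b)" for m
  have p: "p m \<bullet> b = real (m b) / 2 ^ s" if "b \<in> Basis" for m b
    using that by (simp add: p_def)
  have mem: "p m \<in> dyadic_cube s m" for m
    by (simp add: mem_dyadic_cube p divide_right_mono)
  show "\<forall>b\<in>Basis. k b = l b"
  proof
    fix b :: 'a assume b: "b \<in> Basis"
    have "p k \<in> dyadic_cube s l" "p l \<in> dyadic_cube s k"
      using mem eq by blast+
    then have "real (l b) / 2 ^ s \<le> real (k b) / 2 ^ s" "real (k b) / 2 ^ s \<le> real (l b) / 2 ^ s"
      using b p unfolding mem_dyadic_cube by metis+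
    then show "k b = l b"
      by (simp add: divide_le_cancel)
  qed
next
  assume "\<forall>b\<in>Basis. k b = l b"
  then show "dyadic_cube s k = dyadic_cube s l"
    by (simp add: dyadic_cube_def)
qed

lemma card_dyadic_cubes:
  "card (dyadic_cubes s :: 'a::euclidean_space set set) = 2 ^ (DIM('a) * s)"
proof -
  have "bij_betw (dyadic_cube s) (Basis \<rightarrow>\<^sub>E {..<2 ^ s}) (dyadic_cubes s :: 'a set set)"
    unfolding bij_betw_def
  proof
    show "inj_on (dyadic_cube s) (Basis \<rightarrow>\<^sub>E {..<2 ^ s} :: ('a \<Rightarrow> nat) set)"
      by (auto simp: inj_on_def dyadic_cube_eq_iff intro: PiE_ext)
    show "dyadic_cube s ` (Basis \<rightarrow>\<^sub>E {..<2 ^ s}) = (dyadic_cubes s :: 'a set set)"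
    proof (intro equalityI subsetI)
      fix Q :: "'a set" assume "Q \<in> dyadic_cubes s"
      then obtain k where k: "Q = dyadic_cube s k" "\<forall>b\<in>Basis. k b < 2 ^ s"
        by (auto simp: dyadic_cubes_def)
      then have "Q = dyadic_cube s (restrict k Basis)"
        by (simp add: dyadic_cube_eq_iff)
      with k show "Q \<in> dyadic_cube s ` (Basis \<rightarrow>\<^sub>E {..<2 ^ s})"
        by (intro image_eqI[of _ _ "restrict k Basis"]) auto
    qed (auto simp: dyadic_cubes_def PiE_iff)
  qed
  then show ?thesis
    by (auto dest!: bij_betw_same_card simp: card_PiE power_mult mult.commute)
qed

end

theory Submission imports Defs begin

text \<open>
  The function is the \<open>n\<close>-dimensional Hilbert curve. Put \<open>N = 2\<^sup>n\<close>. The curve is self-similar: on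
  the \<open>j\<close>-th of the \<open>N\<close> equal pieces of the unit interval it is the image of the whole curve under a
  map \<open>T\<^sub>j\<close>, which is a symmetry of the unit cube followed by the contraction onto one of the \<open>N\<close> half
  size subcubes. Each subcube is the image under exactly one \<open>T\<^sub>j\<close>.

  Such a curve exists and is continuous as soon as the pieces fit together: \<open>T\<^sub>0\<close> fixes the starting
  point \<open>a\<close>, the last map fixes the end point \<open>b\<close>, and \<open>T\<^sub>j b = T\<^sub>j\<^sub>+\<^sub>1 a\<close>
  (\<open>self_similar_curve\<close>). It fills the cube because the images of the cube under the \<open>T\<^sub>j\<close> cover it.

  The endpoints are \<open>a = 0\<close> and a neighbouring corner \<open>b\<close>. The subcubes are visited in the order of
  the binary reflected Gray code, so consecutive ones share a face. Describe a corner of the \<open>j\<close>-th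
  subcube by the set of coordinates in which it differs from the corner which that subcube shares with
  the unit cube. In these terms two adjacent subcubes meet at a common corner exactly if the two sets
  are equal and contain the coordinate that is flipped between them. So it suffices to find
  a sequence of sets \<open>r\<^sub>0, \<dots>, r\<^sub>N\<close>, where \<open>r\<^sub>j\<close> and \<open>r\<^sub>j\<^sub>+\<^sub>1\<close> are the entry and the exit corner of the
  \<open>j\<close>-th subcube: \<open>r\<^sub>0\<close> and \<open>r\<^sub>N\<close> must be empty, \<open>r\<^sub>j\<close> must contain the coordinate \<open>k\<^sub>j\<close> flipped by the
  \<open>j\<close>-th step, and consecutive sets must differ in one element, because \<open>a\<close> and \<open>b\<close> do. Since every
  odd step of the Gray code flips the same coordinate \<open>z\<close>, the choice \<open>r\<^sub>j = {z, k\<^sub>j}\<close> for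
  \<open>0 < j < N\<close> works (\<open>hilbert_subcube_maps\<close>).

  Both clauses of cube preservation follow by induction on the level
  (\<open>self_similar_curve_cubes_preserving\<close>). An interval of level \<open>s + 1\<close> is an interval of level \<open>s\<close>
  scaled into one of the \<open>N\<close> pieces, and \<open>T\<^sub>j\<close> carries dyadic cubes to dyadic cubes of the next level.
  For the preimages, a point of the curve in the open subcube number \<open>j\<close> can only come from
  the piece number \<open>j\<close>, because distinct subcubes have disjoint interiors and each is visited once.
\<close>

section \<open>Self-similar curves\<close>

lemma unit_interval_piece:
  assumes "0 < N" "t \<in> {0..1::real}"
  obtains j u where "j < N" "u \<in> {0..1}" "t = (real j + u) / real N"
proof (cases "t = 1")
  case True
  show ?thesis
    by (rule that[of "N - 1" 1]) (use True assms in \<open>auto simp: field_simps of_nat_diff\<close>)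
next
  case False
  define j where "j = nat \<lfloor>real N * t\<rfloor>"
  have nonneg: "0 \<le> real N * t" and less: "real N * t < real N"
    using assms False by auto
  have j: "real j \<le> real N * t" "real N * t < real j + 1"
    using nonneg unfolding j_def by linarith+
  show ?thesis
  proof (rule that[of j "real N * t - real j"])
    show "j < N" using j less by linarith
    show "real N * t - real j \<in> {0..1}" using j by auto
    show "t = (real j + (real N * t - real j)) / real N" using assms by (simp add: field_simps)
  qed
qed

text \<open>
  The curve solves the functional equation \<open>f ((j + u) / N) = T\<^sub>j (f u)\<close>. Read as a recipe for a new
  function, the right-hand side is an operator that contracts distances by the factor \<open>q\<close> and, thanks to
  the matching conditions at the endpoints, preserves continuity. Its iterates, starting from the segment
  from \<open>a\<close> to \<open>b\<close>, therefore converge uniformly. Convexity of \<open>S\<close> serves to keep this first curve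
  inside \<open>S\<close>. The image is dense in \<open>S\<close>, since every point of \<open>S\<close> lies in \<open>m\<close>-fold images of \<open>S\<close> of
  diameter at most \<open>q\<^sup>m\<close> times that of \<open>S\<close>, and each of them contains a piece of the curve; being compact,
  the image is all of \<open>S\<close>.
\<close>

lemma self_similar_curve:
  fixes T :: "nat \<Rightarrow> 'a::banach \<Rightarrow> 'a"
  assumes N: "0 < N" and q: "0 \<le> q" "q < 1"
    and contr: "\<And>j x y. j < N \<Longrightarrow> dist (T j x) (T j y) \<le> q * dist x y"
    and S: "compact S" "convex S" "S = (\<Union>j<N. T j ` S)"
    and ab: "a \<in> S" "b \<in> S" "T 0 a = a" "T (N - 1) b = b"
    and join: "\<And>j. Suc j < N \<Longrightarrow> T j b = T (Suc j) a"
  obtains f where "continuous_on {0..1} f" "f ` {0..1} = S"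
    "\<And>j u. j < N \<Longrightarrow> u \<in> {0..1} \<Longrightarrow> f ((real j + u) / real N) = T j (f u)"
proof -
  define \<Phi> where
    "\<Phi> g t = (let j = min (N - 1) (nat \<lfloor>real N * t\<rfloor>) in T j (g (real N * t - real j)))"
    for g :: "real \<Rightarrow> 'a" and t
  \<comment> \<open>The minimum assigns the right end \<open>t = 1\<close> to the last piece; a point between two pieces goes to
    the right one, which by \<open>join\<close> makes no difference for functions from \<open>a\<close> to \<open>b\<close>.\<close>
  define G where
    "G = {g :: real \<Rightarrow> 'a. continuous_on {0..1} g \<and> g 0 = a \<and> g 1 = b \<and> g ` {0..1} \<subseteq> S}"
  have \<Phi>: "\<Phi> g ((real j + u) / real N) = T j (g u)"
    if g: "g \<in> G" and j: "j < N" and u: "u \<in> {0..1}" for g j u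
  proof (cases "u = 1 \<and> Suc j < N")
    case True
    then have "nat \<lfloor>real N * ((real j + u) / real N)\<rfloor> = Suc j"
      using N by (simp add: nat_eq_iff floor_eq_iff)
    moreover have "min (N - 1) (Suc j) = Suc j"
      using True by (auto simp: min_def)
    ultimately have "\<Phi> g ((real j + u) / real N) = T (Suc j) (g 0)"
      unfolding \<Phi>_def using True N by (simp only: Let_def) simp
    then show ?thesis
      using True g join by (simp add: G_def)
  next
    case False
    have *: "real N * ((real j + u) / real N) = real j + u"
      using N by simp
    have "min (N - 1) (nat \<lfloor>real j + u\<rfloor>) = j"
    proof (cases "u = 1")
      case True
      then have "j = N - 1" using False j by auto
      then show ?thesis using True by simp
    next
      case False
      then have "nat \<lfloor>real j + u\<rfloor> = j"
        using u by (simp add: nat_eq_iff floor_eq_iff)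
      then show ?thesis using j by simp
    qed
    then show ?thesis
      unfolding \<Phi>_def * by (simp add: Let_def)
  qed
  have T_cont: "continuous_on X (T j)" if "j < N" for j X
  proof (rule lipschitz_on_continuous_on[of q])
    show "q-lipschitz_on X (T j)"
      using contr that q by (auto simp: lipschitz_on_def)
  qed
  have \<Phi>_G: "\<Phi> g \<in> G" if g: "g \<in> G" for g
  proof -
    define I where "I j = {real j / real N .. (real j + 1) / real N}" for j
    have cover: "{0..1} = (\<Union>j<N. I j)"
    proof (intro equalityI subsetI)
      fix t :: real assume "t \<in> {0..1}"
      with N obtain j u where "j < N" "u \<in> {0..1}" "t = (real j + u) / real N"
        by (rule unit_interval_piece)
      then show "t \<in> (\<Union>j<N. I j)"
        using N by (auto simp: I_def divide_right_mono intro!: bexI[of _ j])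
    next
      fix t assume "t \<in> (\<Union>j<N. I j)"
      then obtain j where j: "j < N" "real j \<le> real N * t" "real N * t \<le> real j + 1"
        using N by (auto simp: I_def field_simps)
      then have "0 \<le> real N * t" "real N * t \<le> real N * 1"
        using N by linarith+
      then show "t \<in> {0..1}"
        using N by (simp add: zero_le_mult_iff)
    qed
    have "continuous_on (\<Union>j\<in>{..<N}. I j) (\<Phi> g)"
    proof (rule continuous_on_closed_Union)
      fix j assume "j \<in> {..<N}"
      then have j: "j < N" by simp
      have in01: "real N * t - real j \<in> {0..1}" if "t \<in> I j" for t
        using that N by (auto simp: I_def field_simps)
      have "continuous_on (I j) (\<lambda>t. T j (g (real N * t - real j)))"
      proof (rule continuous_on_compose2[OF T_cont[OF j, of UNIV]])
        show "continuous_on (I j) (\<lambda>t. g (real N * t - real j))"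
          by (rule continuous_on_compose2[of "{0..1}" g])
            (use g in01 in \<open>auto simp: G_def intro!: continuous_intros\<close>)
      qed auto
      moreover have "T j (g (real N * t - real j)) = \<Phi> g t" if "t \<in> I j" for t
        using \<Phi>[OF g j in01[OF that]] N by simp
      ultimately show "continuous_on (I j) (\<Phi> g)"
        by (simp add: continuous_on_eq)
    qed (auto simp: I_def)
    moreover have "\<Phi> g 0 = a"
      using \<Phi>[OF g N, of 0] g ab by (simp add: G_def)
    moreover have "\<Phi> g 1 = b"
      using \<Phi>[OF g, of "N - 1" 1] g ab N by (simp add: G_def of_nat_diff)
    moreover have "\<Phi> g t \<in> S" if t: "t \<in> {0..1}" for t
    proof -
      obtain j u where jut: "j < N" "u \<in> {0..1}" "t = (real j + u) / real N"
        using N t by (rule unit_interval_piece)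
      then have "g u \<in> S"
        using g by (auto simp: G_def)
      then have "T j (g u) \<in> S"
        using jut S(3) by blast
      then show ?thesis
        using \<Phi>[OF g] jut by simp
    qed
    ultimately show ?thesis
      unfolding cover[symmetric] by (auto simp: G_def)
  qed
  define g where "g m = (\<Phi> ^^ m) (linepath a b)" for m
  have gG: "g m \<in> G" for m
  proof (induction m)
    case 0
    have "closed_segment a b \<subseteq> S"
      using S(2) ab by (simp add: closed_segment_subset)
    then show ?case
      using path_image_linepath[of a b]
      by (auto simp: g_def G_def linepath_0' linepath_1' path_image_def)
  next
    case (Suc m)
    then show ?case
      using \<Phi>_G by (simp add: g_def)
  qed
  have gS: "g m t \<in> S" if "t \<in> {0..1}" for m t
    using gG[of m] that by (auto simp: G_def)
  have g_Suc: "g (Suc m) ((real j + u) / real N) = T j (g m u)"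
    if "j < N" "u \<in> {0..1}" for m j u
    using \<Phi>[OF gG that] by (simp add: g_def)
  define D where "D = diameter S"
  have D: "dist x y \<le> D" if "x \<in> S" "y \<in> S" for x y
    using that S(1) by (simp add: D_def diameter_bounded_bound compact_imp_bounded)
  have close: "dist (g m t) (g (m + p) t) \<le> q ^ m * D" if "t \<in> {0..1}" for m p t
    using that
  proof (induction m arbitrary: t)
    case 0
    then show ?case
      by (simp add: D gS)
  next
    case (Suc m)
    obtain j u where jut: "j < N" "u \<in> {0..1}" "t = (real j + u) / real N"
      using N Suc.prems by (rule unit_interval_piece)
    have "dist (g (Suc m) t) (g (Suc m + p) t) = dist (T j (g m u)) (T j (g (m + p) u))"
      using jut g_Suc by simp
    also have "\<dots> \<le> q * dist (g m u) (g (m + p) u)"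
      using contr jut by simp
    also have "\<dots> \<le> q * (q ^ m * D)"
      using Suc.IH[OF jut(2)] q by (intro mult_left_mono)
    finally show ?case by simp
  qed
  have small: "\<exists>m. q ^ m * D < e" if "0 < e" for e
  proof -
    have "(\<lambda>m. q ^ m * D) \<longlonglongrightarrow> 0 * D"
      using q by (intro tendsto_mult LIMSEQ_power_zero tendsto_const) auto
    then have "eventually (\<lambda>m. q ^ m * D < e) sequentially"
      using that by (intro order_tendstoD) auto
    then show ?thesis
      by (auto simp: eventually_sequentially)
  qed
  have "uniformly_Cauchy_on {0..1} g"
    unfolding uniformly_Cauchy_on_def
  proof (intro allI impI)
    fix e :: real assume "0 < e"
    then obtain M where M: "q ^ M * D < e / 2"
      using small[of "e / 2"] by auto
    show "\<exists>M. \<forall>t\<in>{0..1}. \<forall>m\<ge>M. \<forall>n\<ge>M. dist (g m t) (g n t) < e"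
    proof (intro exI[of _ M] ballI allI impI)
      fix t m n assume t: "t \<in> {0..1::real}" and "M \<le> m" "M \<le> n"
      then have "dist (g M t) (g m t) \<le> q ^ M * D" "dist (g M t) (g n t) \<le> q ^ M * D"
        using close[OF t, of M "m - M"] close[OF t, of M "n - M"] by simp_all
      then show "dist (g m t) (g n t) < e"
        using M dist_triangle3[of "g m t" "g n t" "g M t"] by linarith
    qed
  qed
  then obtain f where f: "uniform_limit {0..1} g f sequentially"
    using Cauchy_uniformly_convergent uniformly_convergent_on_def by blast
  have lim: "(\<lambda>m. g m t) \<longlonglongrightarrow> f t" if "t \<in> {0..1}" for t
    using f that by (rule tendsto_uniform_limitI)
  have f_cont: "continuous_on {0..1} f"
    using f by (rule uniform_limit_theorem[rotated]) (use gG in \<open>auto simp: G_def\<close>)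
  have f_eq: "f ((real j + u) / real N) = T j (f u)" if j: "j < N" and u: "u \<in> {0..1}" for j u
  proof -
    have "(real j + u) / real N \<in> {0..1}"
      using j u N by (auto simp: field_simps)
    then have "(\<lambda>m. g (Suc m) ((real j + u) / real N)) \<longlonglongrightarrow> f ((real j + u) / real N)"
      using lim by (intro LIMSEQ_Suc)
    moreover have "(\<lambda>m. T j (g m u)) \<longlonglongrightarrow> T j (f u)"
      using continuous_on_tendsto_compose[OF T_cont[OF j, of UNIV] lim[OF u]] by simp
    ultimately show ?thesis
      using g_Suc[OF j u] LIMSEQ_unique by simp
  qed
  have f_S: "f t \<in> S" if "t \<in> {0..1}" for t
    using closed_sequentially[OF compact_imp_closed[OF S(1)] gS[OF that] lim[OF that]] .
  have dense: "\<exists>t\<in>{0..1}. dist (f t) x \<le> q ^ m * D" if "x \<in> S" for m x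
    using that
  proof (induction m arbitrary: x)
    case 0
    then show ?case
      using D f_S by (auto intro!: bexI[of _ 0])
  next
    case (Suc m)
    have "x \<in> (\<Union>j<N. T j ` S)"
      using Suc.prems by (rule subsetD[OF equalityD1[OF S(3)]])
    then obtain j y where j: "j < N" and y: "y \<in> S" "x = T j y"
      by blast
    obtain u where u: "u \<in> {0..1}" "dist (f u) y \<le> q ^ m * D"
      using Suc.IH[OF y(1)] by auto
    have "dist (f ((real j + u) / real N)) x \<le> q * dist (f u) y"
      using f_eq j u y contr by simp
    also have "\<dots> \<le> q * (q ^ m * D)"
      using u q by (intro mult_left_mono)
    finally show ?case
      using j u N by (intro bexI[of _ "(real j + u) / real N"]) (auto simp: field_simps)
  qed
  have "S \<subseteq> f ` {0..1}"
  proof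
    fix x assume x: "x \<in> S"
    have "closed (f ` {0..1})"
      using f_cont compact_continuous_image compact_imp_closed by blast
    moreover have "\<exists>y\<in>f ` {0..1}. dist y x < e" if "0 < e" for e
      using small[OF that] dense[OF x] by (meson imageI le_less_trans)
    ultimately show "x \<in> f ` {0..1}"
      using closed_approachable[of "f ` {0..1}" x] by blast
  qed
  with f_S have "f ` {0..1} = S" by auto
  from f_cont this f_eq show thesis by (rule that)
qed

section \<open>Gray codes\<close>

definition gray :: "nat \<Rightarrow> nat \<Rightarrow> bool" where
  "gray j m \<longleftrightarrow> bit j m \<noteq> bit j (Suc m)"

lemma gray_0: "gray j 0 \<longleftrightarrow> odd j \<noteq> odd (j div 2)"
  by (simp add: gray_def bit_0 bit_Suc)

lemma gray_Suc: "gray j (Suc m) = gray (j div 2) m"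
  by (simp add: gray_def bit_Suc)

lemma gray_bound:
  assumes "j < 2 ^ n" "gray j m"
  shows "m < n"
proof (rule ccontr)
  assume "\<not> m < n"
  then have "j < 2 ^ m"
    using assms(1) power_increasing[of n m "2::nat"] by (auto intro: less_le_trans)
  then have "j < 2 ^ m" "j < 2 ^ Suc m"
    by simp_all
  then have "j div 2 ^ m = 0" "j div 2 ^ Suc m = 0"
    by (simp_all only: div_less)
  with assms(2) show False
    by (simp add: gray_def bit_iff_odd)
qed

text \<open>
  Removing the lowest digit of an odd \<open>j\<close> and of its successor leaves consecutive numbers, and the lowest
  Gray digits of the two agree; so the flip occurs one place higher than in the halved numbers. For even
  \<open>j\<close> the halves coincide, and only the lowest Gray digit changes.
\<close>

lemma gray_step: "\<exists>k. (\<forall>m. gray (Suc j) m \<longleftrightarrow> gray j m \<noteq> (m = k)) \<and> (k = 0 \<longleftrightarrow> even j)"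
proof (induction j rule: less_induct)
  case (less j)
  show ?case
  proof (cases "even j")
    case True
    then have *: "Suc j div 2 = j div 2" by presburger
    have "gray (Suc j) m \<longleftrightarrow> gray j m \<noteq> (m = 0)" for m
      using True * by (cases m) (simp_all add: gray_0 gray_Suc)
    with True show ?thesis by blast
  next
    case False
    then have *: "Suc j div 2 = Suc (j div 2)" and "j div 2 < j" by presburger+
    then obtain k where k: "gray (Suc (j div 2)) m \<longleftrightarrow> gray (j div 2) m \<noteq> (m = k)" for m
      using less by blast
    have "gray (Suc j) m \<longleftrightarrow> gray j m \<noteq> (m = Suc k)" for m
      using False * k by (cases m) (simp_all add: gray_0 gray_Suc)
    with False show ?thesis by blast
  qed
qed

lemma gray_surj: "\<exists>j<2 ^ n. \<forall>m<n. gray j m \<longleftrightarrow> c m"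
proof (induction n arbitrary: c)
  case (Suc n)
  from Suc[of "\<lambda>m. c (Suc m)"] obtain i where i: "i < 2 ^ n" "\<forall>m<n. gray i m \<longleftrightarrow> c (Suc m)"
    by auto
  define j where "j = 2 * i + of_bool (c 0 \<noteq> odd i)"
  have j: "j div 2 = i" "odd j \<longleftrightarrow> c 0 \<noteq> odd i"
    by (simp_all add: j_def)
  have "j < 2 ^ Suc n"
    using i by (auto simp: j_def)
  moreover have "gray j m \<longleftrightarrow> c m" if "m < Suc n" for m
    using that i j by (cases m) (auto simp: gray_0 gray_Suc)
  ultimately show ?case by blast
qed simp

text \<open>
  Read through an enumeration of the coordinates, the Gray code is a Hamiltonian path on the corners of
  the cube, from the origin to a neighbouring corner. Here \<open>k j\<close> is the coordinate flipped on the step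
  into the \<open>j\<close>-th corner.
\<close>

lemma gray_path:
  fixes N :: nat
  defines "N \<equiv> 2 ^ CARD('n::finite)"
  obtains c :: "nat \<Rightarrow> 'n::finite \<Rightarrow> bool" and k z top where
    "bij_betw c {..<N} UNIV"
    "c 0 = (\<lambda>i. False)" "c (N - 1) = (\<lambda>i. i = top)"
    "\<And>j. Suc j < N \<Longrightarrow> c (Suc j) = (\<lambda>i. c j i \<noteq> (i = k (Suc j)))"
    "\<And>j. 0 < j \<Longrightarrow> j < N \<Longrightarrow> k j = z \<longleftrightarrow> odd j"
proof -
  obtain pos :: "'n \<Rightarrow> nat" where pos: "bij_betw pos UNIV {0..<CARD('n)}"
    using ex_bij_betw_finite_nat[of "UNIV :: 'n set"] by auto
  define coord where "coord = inv pos"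
  have coord: "pos (coord m) = m" if "m < CARD('n)" for m
    using that pos unfolding coord_def bij_betw_def by (simp add: f_inv_into_f)
  have pos_coord: "pos i = m \<longleftrightarrow> i = coord m" if "m < CARD('n)" for i m
    using coord[OF that] bij_betw_imp_inj_on[OF pos] by (auto dest: injD)
  have pos_less: "pos i < CARD('n)" for i
    using pos unfolding bij_betw_def by auto
  obtain K where K: "\<And>j m. gray (Suc j) m \<longleftrightarrow> gray j m \<noteq> (m = K j)" "\<And>j. K j = 0 \<longleftrightarrow> even j"
    using gray_step by metis
  have K_less: "K j < CARD('n)" if "Suc j < N" for j
  proof -
    have "gray (Suc j) (K j) \<or> gray j (K j)"
      using K(1)[of j "K j"] by simp
    moreover have "Suc j < 2 ^ CARD('n)" "j < 2 ^ CARD('n)"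
      using that by (simp_all add: N_def)
    ultimately show ?thesis
      using gray_bound by blast
  qed
  define c where "c j = (\<lambda>i. gray j (pos i))" for j
  have "c ` {..<N} = UNIV"
  proof (intro equalityI subsetI)
    fix d :: "'n \<Rightarrow> bool"
    obtain j where j: "j < N" "\<forall>m<CARD('n). gray j m \<longleftrightarrow> d (coord m)"
      using gray_surj[of "CARD('n)" "\<lambda>m. d (coord m)"] unfolding N_def by blast
    have "coord (pos i) = i" for i
      using pos_coord[OF pos_less, of i i] by simp
    then have "c j = d"
      using j(2) pos_less by (simp add: c_def)
    with j(1) show "d \<in> c ` {..<N}" by auto
  qed simp
  moreover have "inj_on c {..<N}"
  proof (rule eq_card_imp_inj_on)
    have "card (UNIV :: ('n \<Rightarrow> bool) set) = N"
      by (simp add: N_def card_fun)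
    then show "card (c ` {..<N}) = card {..<N}"
      using calculation by simp
  qed simp
  ultimately have bij: "bij_betw c {..<N} UNIV"
    by (simp add: bij_betw_def)
  show thesis
  proof (rule that[OF bij, of "coord (CARD('n) - 1)" "\<lambda>j. coord (K (j - 1))" "coord 0"])
    show "c 0 = (\<lambda>i. False)"
      by (simp add: c_def gray_def)
    have bits: "bit (N - 1) m \<longleftrightarrow> m < CARD('n)" for m
      unfolding N_def mask_eq_exp_minus_1[symmetric] bit_mask_iff by simp
    have "gray (N - 1) m \<longleftrightarrow> m = CARD('n) - 1" for m
      unfolding gray_def bits using zero_less_card_finite[where 'a='n] by arith
    then show "c (N - 1) = (\<lambda>i. i = coord (CARD('n) - 1))"
      using pos_coord by (simp add: c_def)
    show "c (Suc j) = (\<lambda>i. c j i \<noteq> (i = coord (K (Suc j - 1))))" if "Suc j < N" for j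
      using K_less[OF that] by (simp add: c_def K(1) pos_coord)
    show "coord (K (j - 1)) = coord 0 \<longleftrightarrow> odd j" if j: "0 < j" "j < N" for j
    proof -
      obtain i where i: "j = Suc i" using j(1) by (cases j) auto
      have "coord (K i) = coord 0 \<longleftrightarrow> K i = 0"
        using coord[of "K i"] coord[of 0] K_less[of i] j(2) i by auto
      then show ?thesis
        using K(2) i by simp
    qed
  qed
qed

section \<open>Subcube maps\<close>

text \<open>
  The subcube is the one in the orthant \<open>c\<close>. The coordinates are permuted by \<open>\<pi>\<close> and reflected where \<open>c\<close>
  and \<open>r\<close> differ. The reflection is given through \<open>r\<close> so that \<open>r\<close> alone locates the image of the origin
  relative to the subcube: it is the corner that differs in the coordinates \<open>r\<close> from the corner shared
  with the unit cube.
\<close>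

definition subcube_map :: "('n \<Rightarrow> bool) \<Rightarrow> ('n \<Rightarrow> bool) \<Rightarrow> ('n \<Rightarrow> 'n) \<Rightarrow> real^'n \<Rightarrow> real^'n" where
  "subcube_map c r \<pi> x =
     (\<chi> i. (of_bool (c i) + (if c i \<noteq> r i then 1 - x $ \<pi> i else x $ \<pi> i)) / 2)"

lemma dist_subcube_map:
  assumes "bij \<pi>"
  shows "dist (subcube_map c r \<pi> x) (subcube_map c r \<pi> y) = dist x y / 2"
proof -
  have "dist (subcube_map c r \<pi> x $ i) (subcube_map c r \<pi> y $ i) =
      dist (x $ \<pi> i) (y $ \<pi> i) / 2" for i
    by (auto simp: subcube_map_def dist_real_def abs_if field_simps)
  then have "dist (subcube_map c r \<pi> x) (subcube_map c r \<pi> y) =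
      sqrt (\<Sum>i\<in>UNIV. (dist (x $ \<pi> i) (y $ \<pi> i) / 2)\<^sup>2)"
    unfolding dist_vec_def L2_set_def by (simp only:)
  also have "(\<Sum>i\<in>UNIV. (dist (x $ \<pi> i) (y $ \<pi> i) / 2)\<^sup>2) = (\<Sum>i\<in>UNIV. (dist (x $ i) (y $ i) / 2)\<^sup>2)"
    using assms by (rule sum.reindex_bij_betw)
  also have "sqrt \<dots> = dist x y / 2"
    by (simp add: dist_vec_def L2_set_def power_divide sum_divide_distrib[symmetric] real_sqrt_divide)
  finally show ?thesis .
qed

abbreviation unit_cube :: "(real^'n) set" where
  "unit_cube \<equiv> {x. \<forall>i. 0 \<le> x $ i \<and> x $ i \<le> 1}"

definition grid_cube :: "nat \<Rightarrow> ('n \<Rightarrow> nat) \<Rightarrow> (real^'n) set" where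
  "grid_cube s k = {x. \<forall>i. real (k i) / 2 ^ s \<le> x $ i \<and> x $ i \<le> real (k i + 1) / 2 ^ s}"

lemma interior_grid_cube:
  "interior (grid_cube s k) =
     {x. \<forall>i. real (k i) / 2 ^ s < x $ i \<and> x $ i < real (k i + 1) / 2 ^ s}"
proof -
  have "grid_cube s k = cbox (\<chi> i. real (k i) / 2 ^ s) (\<chi> i. real (k i + 1) / 2 ^ s)"
    by (auto simp: grid_cube_def mem_box_cart)
  then show ?thesis
    by (auto simp: mem_box_cart)
qed

text \<open>
  The index, one level up, of the image of the grid cube with index \<open>k\<close>. A reflection turns the
  \<open>m\<close>-th of \<open>2\<^sup>s\<close> slabs into the one with number \<open>2\<^sup>s - 1 - m\<close>.
\<close>

definition child_index ::
    "('n \<Rightarrow> bool) \<Rightarrow> ('n \<Rightarrow> bool) \<Rightarrow> ('n \<Rightarrow> 'n) \<Rightarrow> nat \<Rightarrow> ('n \<Rightarrow> nat) \<Rightarrow> 'n \<Rightarrow> nat" where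
  "child_index c r \<pi> s k i =
     of_bool (c i) * 2 ^ s + (if c i \<noteq> r i then 2 ^ s - 1 - k (\<pi> i) else k (\<pi> i))"

lemma child_index_less:
  assumes "\<And>i. k i < 2 ^ s"
  shows "child_index c r \<pi> s k i < 2 ^ Suc s"
  using assms[of "\<pi> i"] by (auto simp: child_index_def)

text \<open>
  Every grid cube of the next level is the image of one of the current level under the map into the orthant
  in which it lies; that orthant is read off from the leading binary digits of its index.
\<close>

lemma child_index_surj:
  assumes k: "\<And>i. k i < 2 ^ Suc s" and c: "\<And>i. c i \<longleftrightarrow> 2 ^ s \<le> k i" and \<pi>: "bij \<pi>"
  obtains l where "\<And>i. l i < 2 ^ s" "child_index c r \<pi> s l = k"
proof
  define m where "m i = k i - of_bool (c i) * 2 ^ s" for i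
  define l where "l i' = (let i = inv \<pi> i' in if c i \<noteq> r i then 2 ^ s - 1 - m i else m i)" for i'
  have m: "m i < 2 ^ s" "k i = of_bool (c i) * 2 ^ s + m i" for i
    using k[of i] c[of i] by (auto simp: m_def)
  show "l i < 2 ^ s" for i
    using m(1) by (auto simp: l_def Let_def intro: le_less_trans[OF diff_le_self])
  show "child_index c r \<pi> s l = k"
  proof
    fix i
    have "inv \<pi> (\<pi> i) = i"
      using \<pi> by (simp add: bij_is_inj)
    then show "child_index c r \<pi> s l i = k i"
      using m[of i] by (auto simp: child_index_def l_def)
  qed
qed

lemma subcube_map_grid_cube:
  assumes k: "\<And>i. k i < 2 ^ s" and \<pi>: "bij \<pi>"
  shows "subcube_map c r \<pi> x \<in> grid_cube (Suc s) (child_index c r \<pi> s k) \<longleftrightarrow> x \<in> grid_cube s k"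
    and "subcube_map c r \<pi> x \<in> interior (grid_cube (Suc s) (child_index c r \<pi> s k)) \<longleftrightarrow>
         x \<in> interior (grid_cube s k)"
proof -
  have reindex: "(\<forall>i. P (\<pi> i)) \<longleftrightarrow> (\<forall>i. P i)" for P
    using \<pi> by (metis bij_pointE)
  define K where "K = child_index c r \<pi> s k"
  have K: "real (K i) = of_bool (c i) * 2 ^ s +
      (if c i \<noteq> r i then 2 ^ s - 1 - real (k (\<pi> i)) else real (k (\<pi> i)))" for i
    using k[of "\<pi> i"] by (auto simp: K_def child_index_def of_nat_diff)
  have bounds: "R (real (K i) / 2 ^ Suc s) (subcube_map c r \<pi> x $ i) \<and>
      R (subcube_map c r \<pi> x $ i) (real (K i + 1) / 2 ^ Suc s) \<longleftrightarrow>
      R (real (k (\<pi> i)) / 2 ^ s) (x $ \<pi> i) \<and> R (x $ \<pi> i) (real (k (\<pi> i) + 1) / 2 ^ s)"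
    if "R = (\<le>) \<or> R = (<)" for R i
    using that by (auto simp: subcube_map_def K field_simps)
  show "subcube_map c r \<pi> x \<in> grid_cube (Suc s) (child_index c r \<pi> s k) \<longleftrightarrow> x \<in> grid_cube s k"
    unfolding grid_cube_def mem_Collect_eq K_def[symmetric] bounds[OF disjI1[OF refl]]
    by (rule reindex)
  show "subcube_map c r \<pi> x \<in> interior (grid_cube (Suc s) (child_index c r \<pi> s k)) \<longleftrightarrow>
         x \<in> interior (grid_cube s k)"
    unfolding interior_grid_cube mem_Collect_eq K_def[symmetric] bounds[OF disjI2[OF refl]]
    by (rule reindex)
qed

lemma subcube_map_surj:
  fixes x :: "real^'n"
  assumes "bij \<pi>"
  shows "\<exists>y. subcube_map c r \<pi> y = x"
proof -
  define y :: "real^'n" where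
    "y = (\<chi> l. let i = inv \<pi> l; v = 2 * x $ i - of_bool (c i) in if c i \<noteq> r i then 1 - v else v)"
  have "inv \<pi> (\<pi> i) = i" for i
    using assms by (simp add: bij_is_inj)
  then have "subcube_map c r \<pi> y = x"
    by (simp add: vec_eq_iff subcube_map_def y_def Let_def)
  then show ?thesis ..
qed

lemma unit_cube_eq_grid_cube: "unit_cube = grid_cube 0 (\<lambda>i. 0)"
  by (simp add: grid_cube_def)

text \<open>
  The image of the unit cube under a subcube map is a grid cube of level one. These grid cubes cover the
  unit cube when every orthant \<open>c\<close> occurs.
\<close>

lemma subcube_maps_cover:
  assumes c: "c ` J = UNIV" and \<pi>: "\<And>j. bij (\<pi> j)"
  shows "(\<Union>j\<in>J. subcube_map (c j) (r j) (\<pi> j) ` unit_cube) = unit_cube"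
proof -
  let ?T = "\<lambda>j. subcube_map (c j) (r j) (\<pi> j)"
  have "child_index (c j) (r j) (\<pi> j) 0 (\<lambda>i. 0) = (\<lambda>i. of_bool (c j i))" for j
    by (simp add: child_index_def fun_eq_iff)
  then have T: "?T j y \<in> grid_cube (Suc 0) (\<lambda>i. of_bool (c j i)) \<longleftrightarrow> y \<in> unit_cube" for j y
    using subcube_map_grid_cube(1)[of "\<lambda>i. 0" 0 "\<pi> j" "c j" "r j" y] \<pi>
    unfolding unit_cube_eq_grid_cube by simp
  show ?thesis
  proof (intro equalityI subsetI)
    fix x assume "x \<in> (\<Union>j\<in>J. ?T j ` unit_cube)"
    then obtain j where "x \<in> grid_cube (Suc 0) (\<lambda>i. of_bool (c j i))"
      using T by blast
    then have x: "real (of_bool (c j i)) / 2 \<le> x $ i \<and> x $ i \<le> real (of_bool (c j i) + 1) / 2" for i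
      by (simp add: grid_cube_def)
    have "0 \<le> x $ i \<and> x $ i \<le> 1" for i
      using x[of i] by (cases "c j i") auto
    then show "x \<in> unit_cube" by simp
  next
    fix x :: "real^'a" assume x: "x \<in> unit_cube"
    obtain j where j: "j \<in> J" "c j = (\<lambda>i. 1 / 2 \<le> x $ i)"
      using c by (metis UNIV_I imageE)
    obtain y where y: "?T j y = x"
      using subcube_map_surj \<pi> by blast
    have "x \<in> grid_cube (Suc 0) (\<lambda>i. of_bool (c j i))"
      using x by (auto simp: grid_cube_def j)
    then show "x \<in> (\<Union>j\<in>J. ?T j ` unit_cube)"
      using T[of j y] y j(1) by blast
  qed
qed

section \<open>The Hilbert curve\<close>

text \<open>
  Where the sequence \<open>r\<close> changes by one element \<open>d\<close>, the permutation is chosen to carry the direction from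
  \<open>0\<close> to \<open>b\<close> to the direction \<open>d\<close>, so that \<open>r j\<close> and \<open>r (Suc j)\<close> describe the entry and the exit
  corner of the \<open>j\<close>-th subcube. The corners match at the step flipping \<open>k (Suc j)\<close>: in every other coordinate
  the two subcubes agree, and in that one both corners have the value \<open>1 / 2\<close>, as
  \<open>k (Suc j)\<close> belongs to \<open>r (Suc j)\<close>.
\<close>

lemma hilbert_subcube_maps:
  fixes N :: nat
  defines "N \<equiv> 2 ^ CARD('n::finite)"
  obtains c r :: "nat \<Rightarrow> 'n::finite \<Rightarrow> bool" and \<pi> b where
    "bij_betw c {..<N} UNIV" "\<And>j. bij (\<pi> j)" "b \<in> unit_cube"
    "subcube_map (c 0) (r 0) (\<pi> 0) 0 = 0"
    "subcube_map (c (N - 1)) (r (N - 1)) (\<pi> (N - 1)) b = b"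
    "\<And>j. Suc j < N \<Longrightarrow> subcube_map (c j) (r j) (\<pi> j) b = subcube_map (c (Suc j)) (r (Suc j)) (\<pi> (Suc j)) 0"
proof -
  obtain c :: "nat \<Rightarrow> 'n \<Rightarrow> bool" and k z top where
      bij: "bij_betw c {..<N} UNIV"
    and first: "c 0 = (\<lambda>i. False)" and last: "c (N - 1) = (\<lambda>i. i = top)"
    and step: "\<And>j. Suc j < N \<Longrightarrow> c (Suc j) = (\<lambda>i. c j i \<noteq> (i = k (Suc j)))"
    and odd: "\<And>j. 0 < j \<Longrightarrow> j < N \<Longrightarrow> k j = z \<longleftrightarrow> odd j"
    by (rule gray_path[where 'n='n, folded N_def]) (rule that)
  have N: "even N" "1 < N"
    unfolding N_def using one_less_power[of "2::nat" "CARD('n)"] by simp_all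
  \<comment> \<open>For odd \<open>j\<close> the set is \<open>{z}\<close>, as \<open>k j = z\<close>; for even \<open>j\<close> it has the further element \<open>k j\<close>.
    So the sets of consecutive inner indices differ in the flip of the even one, and those at
    the two ends, \<open>{z}\<close> at \<open>1\<close> and at the odd number \<open>N - 1\<close>, differ from the empty set in \<open>z\<close>.\<close>
  define r where "r j i \<longleftrightarrow> 0 < j \<and> j < N \<and> (i = z \<or> i = k j)" for j i
  have "\<exists>d. r (Suc j) = (\<lambda>i. r j i \<noteq> (i = d))" if j: "j < N" for j
  proof -
    consider "j = 0" | "0 < j" "Suc j = N" | "0 < j" "Suc j < N"
      using j by linarith
    then show ?thesis
    proof cases
      case 1
      then have "r (Suc j) = (\<lambda>i. r j i \<noteq> (i = z))"
        using N odd[of 1] by (auto simp: r_def)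
      then show ?thesis ..
    next
      case 2
      then have "odd j"
        using N(1) by auto
      with 2 have "r (Suc j) = (\<lambda>i. r j i \<noteq> (i = z))"
        using odd[of j] by (auto simp: r_def)
      then show ?thesis ..
    next
      case 3
      then have "r (Suc j) = (\<lambda>i. r j i \<noteq> (i = (if even j then k j else k (Suc j))))"
        using odd[of j] odd[of "Suc j"] by (auto simp: r_def fun_eq_iff)
      then show ?thesis ..
    qed
  qed
  then obtain d where d: "\<And>j. j < N \<Longrightarrow> r (Suc j) = (\<lambda>i. r j i \<noteq> (i = d j))"
    by metis
  define b :: "real^'n" where "b = axis top 1"
  \<comment> \<open>Any permutation that maps \<open>d j\<close> to \<open>top\<close> would do.\<close>
  define \<pi> where "\<pi> j = Transposition.transpose (d j) top" for j
  let ?T = "\<lambda>j. subcube_map (c j) (r j) (\<pi> j)"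
  have entry: "?T j 0 $ i = (of_bool (c j i) + of_bool (c j i \<noteq> r j i)) / 2" for j i
    by (simp add: subcube_map_def)
  have exit: "?T j b $ i = (of_bool (c j i) + of_bool (c j i \<noteq> r (Suc j) i)) / 2" if "j < N" for j i
  proof -
    have "b $ \<pi> j i = of_bool (i = d j)"
      by (auto simp: b_def \<pi>_def axis_def Transposition.transpose_def)
    then show ?thesis
      by (auto simp: subcube_map_def d[OF that])
  qed
  show thesis
  proof (rule that[OF bij, of \<pi> b r])
    show "bij (\<pi> j)" for j
      by (simp add: \<pi>_def)
    show "b \<in> unit_cube"
      by (simp add: b_def axis_def)
    show "?T 0 0 = 0"
      unfolding vec_eq_iff entry by (simp add: first r_def)
    show "?T (N - 1) b = b"
    proof -
      have "N - 1 < N" "Suc (N - 1) = N"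
        using N by simp_all
      then show ?thesis
        unfolding vec_eq_iff exit[OF \<open>N - 1 < N\<close>]
        unfolding last \<open>Suc (N - 1) = N\<close> by (simp add: r_def b_def axis_def)
    qed
    show "?T j b = ?T (Suc j) 0" if j: "Suc j < N" for j
    proof -
      have "r (Suc j) (k (Suc j))"
        using j by (simp add: r_def)
      then show ?thesis
        unfolding vec_eq_iff entry exit[OF Suc_lessD[OF j]]
        unfolding step[OF j] by auto
    qed
  qed
qed

lemma nested_interval_iff:
  fixes N M j m :: nat
  assumes "0 < N" "0 < M"
  shows "(real j + u) / real N
      \<in> {real (j * M + m) / real (N * M) .. real (j * M + m + 1) / real (N * M)} \<longleftrightarrow>
    u \<in> {real m / real M .. real (m + 1) / real M}"
proof -
  have "real (j * M + m) / real (N * M) = (real j + real m / real M) / real N" for m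
    using assms by (simp add: field_simps)
  from this[of m] this[of "m + 1"] show ?thesis
    using assms by (simp add: divide_le_cancel add.assoc)
qed

text \<open>
  The functional equation moves both clauses from one level to the next: the first because a subcube map
  takes dyadic cubes to dyadic cubes, the second because a point of the curve inside the orthant \<open>c j\<close>
  can only come from the \<open>j\<close>-th piece, \<open>c\<close> being injective.
\<close>

lemma self_similar_curve_cubes_preserving:
  fixes f :: "real \<Rightarrow> real^'n" and N :: nat
  defines "N \<equiv> 2 ^ CARD('n)"
  assumes c: "bij_betw c {..<N} UNIV" and \<pi>: "\<And>j. bij (\<pi> j)"
    and f_cube: "f ` {0..1} \<subseteq> unit_cube"
    and f_eq: "\<And>j u. j < N \<Longrightarrow> u \<in> {0..1} \<Longrightarrow>
      f ((real j + u) / real N) = subcube_map (c j) (r j) (\<pi> j) (f u)"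
  shows "cubes_preserving f"
proof -
  have N: "0 < N"
    by (simp add: N_def)
  define I where "I s m = {real m / real (N ^ s) .. real (m + 1) / real (N ^ s)}" for s m
  have I_split: "(real j + u) / real N \<in> I (Suc s) (j * N ^ s + m) \<longleftrightarrow> u \<in> I s m" for j u s m
    using nested_interval_iff[of N "N ^ s" j u m] N by (simp add: I_def)
  have I_unit: "I s m \<subseteq> {0..1}" if "m < N ^ s" for s m
  proof -
    have "real (m + 1) \<le> real (N ^ s)"
      using that by (simp only: of_nat_le_iff)
    then show ?thesis
      using N by (auto simp: I_def divide_le_eq intro: order_trans[rotated])
  qed
  have image: "\<exists>k. (\<forall>i. k i < 2 ^ s) \<and> f ` I s m \<subseteq> grid_cube s k" if "m < N ^ s" for s m
    using that
  proof (induction s arbitrary: m)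
    case 0
    then show ?case
      using f_cube by (intro exI[of _ "\<lambda>i. 0"]) (simp add: I_def unit_cube_eq_grid_cube)
  next
    case (Suc s)
    define j m' where "j = m div N ^ s" and "m' = m mod N ^ s"
    have jm: "j < N" "m' < N ^ s" "m = j * N ^ s + m'"
      using Suc.prems N div_mult_mod_eq[of m "N ^ s"]
      by (simp_all add: j_def m'_def less_mult_imp_div_less)
    obtain k where k: "\<And>i. k i < 2 ^ s" "f ` I s m' \<subseteq> grid_cube s k"
      using Suc.IH[OF jm(2)] by blast
    let ?k = "child_index (c j) (r j) (\<pi> j) s k"
    have "f t \<in> grid_cube (Suc s) ?k" if t: "t \<in> I (Suc s) m" for t
    proof -
      define u where "u = real N * t - real j"
      have tu: "t = (real j + u) / real N"
        using N by (simp add: u_def)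
      have u: "u \<in> I s m'"
        using t I_split unfolding jm(3) tu by blast
      then have "u \<in> {0..1}"
        using I_unit[OF jm(2)] by blast
      then show ?thesis
        using f_eq[OF jm(1)] subcube_map_grid_cube(1)[of k s "\<pi> j", OF k(1) \<pi>] k(2) u unfolding tu by auto
    qed
    moreover have "?k i < 2 ^ Suc s" for i
      using k(1) by (rule child_index_less)
    ultimately show ?case by blast
  qed
  have preimage: "\<exists>m < N ^ s. \<forall>t\<in>{0..1}. f t \<in> interior (grid_cube s k) \<longrightarrow> t \<in> I s m"
    if "\<And>i. k i < 2 ^ s" for s k
    using that
  proof (induction s arbitrary: k)
    case 0
    then show ?case by (simp add: I_def)
  next
    case (Suc s)
    obtain j where j: "j < N" "c j = (\<lambda>i. 2 ^ s \<le> k i)"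
      using c unfolding bij_betw_def by (metis UNIV_I imageE lessThan_iff)
    obtain l where l: "\<And>i. l i < 2 ^ s" "child_index (c j) (r j) (\<pi> j) s l = k"
      using child_index_surj[of k s "c j" "\<pi> j" "r j"] Suc.prems \<pi> j(2) by metis
    obtain m where m: "m < N ^ s" "\<And>u. u \<in> {0..1} \<Longrightarrow> f u \<in> interior (grid_cube s l) \<Longrightarrow> u \<in> I s m"
      using Suc.IH[of l, OF l(1)] by blast
    have "t \<in> I (Suc s) (j * N ^ s + m)"
      if t: "t \<in> {0..1}" and ft: "f t \<in> interior (grid_cube (Suc s) k)" for t
    proof -
      obtain i u where iu: "i < N" "u \<in> {0..1}" "t = (real i + u) / real N"
        using N t by (rule unit_interval_piece)
      let ?x = "subcube_map (c i) (r i) (\<pi> i) (f u)"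
      have f: "f t = ?x"
        using f_eq iu by simp
      \<comment> \<open>A point in the interior of a dyadic cube of positive level is not on a wall \<open>x $ h = 1 / 2\<close>,
        so it determines its orthant, hence the piece of the interval from which it comes.\<close>
      have "c i h \<longleftrightarrow> 2 ^ s \<le> k h" for h
      proof -
        have fu: "0 \<le> f u $ \<pi> i h" "f u $ \<pi> i h \<le> 1"
          using f_cube iu(2) by blast+
        have x: "real (k h) / 2 ^ Suc s < ?x $ h" "?x $ h < real (k h + 1) / 2 ^ Suc s"
          using ft unfolding f interior_grid_cube by blast+
        show ?thesis
        proof (cases "c i h")
          case True
          then have "1 / 2 \<le> ?x $ h"
            using fu by (simp add: subcube_map_def)
          with x(2) have "1 / 2 < real (k h + 1) / 2 ^ Suc s"
            by linarith
          then have "real (2 ^ s) < real (k h + 1)"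
            by (simp add: field_simps)
          then show ?thesis
            using True by (simp only: of_nat_less_iff) simp
        next
          case False
          then have "?x $ h \<le> 1 / 2"
            using fu by (simp add: subcube_map_def)
          with x(1) have "real (k h) / 2 ^ Suc s < 1 / 2"
            by linarith
          then have "real (k h) < real (2 ^ s)"
            by (simp add: field_simps)
          then show ?thesis
            using False by (simp only: of_nat_less_iff) simp
        qed
      qed
      then have "c i = c j"
        by (simp add: j(2) fun_eq_iff)
      then have "i = j"
        using inj_onD[OF bij_betw_imp_inj_on[OF c], of i j] iu(1) j(1) by simp
      then have "f u \<in> interior (grid_cube s l)"
        using ft subcube_map_grid_cube(2)[of l s "\<pi> j", OF l(1) \<pi>] l(2) unfolding f by blast
      then show ?thesis
        using m(2) iu(2) I_split unfolding iu(3) \<open>i = j\<close> by blast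
    qed
    moreover have "j * N ^ s + m < N ^ Suc s"
    proof -
      have "j * N ^ s + m < Suc j * N ^ s"
        using m(1) by simp
      also have "\<dots> \<le> N * N ^ s"
        using j(1) by (intro mult_right_mono) auto
      finally show ?thesis by simp
    qed
    ultimately show ?case by blast
  qed
  have intervals: "dyadic_cubes (CARD('n) * s) = {I s m | m. m < N ^ s}" for s
    unfolding dyadic_cubes_real I_def N_def by (simp add: power_mult)
  have cubes: "dyadic_cubes s = {grid_cube s k | k. \<forall>i. k i < 2 ^ s}"
    for s :: nat unfolding dyadic_cubes_vec grid_cube_def ..
  show ?thesis
    unfolding cubes_preserving_def intervals cubes
  proof (intro conjI allI ballI)
    show "f ` {0..1} \<subseteq> unit_cube" by (rule f_cube)
  next
    fix s \<alpha> assume "\<alpha> \<in> {I s m | m. m < N ^ s}"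
    then obtain m where m: "\<alpha> = I s m" "m < N ^ s" by blast
    from image[OF m(2)]
    show "\<exists>\<delta>\<in>{grid_cube s k | k. \<forall>i. k i < 2 ^ s}. f ` \<alpha> \<subseteq> \<delta>"
      unfolding m(1) by blast
  next
    fix s and \<delta> :: "(real^'n) set" assume "\<delta> \<in> {grid_cube s k | k. \<forall>i. k i < 2 ^ s}"
    then obtain k where k: "\<delta> = grid_cube s k" "\<And>i. k i < 2 ^ s" by blast
    from preimage[of k, OF k(2)]
    obtain m where "m < N ^ s" "{t \<in> {0..1}. f t \<in> interior \<delta>} \<subseteq> I s m"
      unfolding k(1) by blast
    then show "\<exists>\<alpha>\<in>{I s m | m. m < N ^ s}. {t \<in> {0..1}. f t \<in> interior \<delta>} \<subseteq> \<alpha>"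
      by blast
  qed
qed

theorem theorem3:
  "\<exists>f :: real \<Rightarrow> real^'n.
     continuous_on {0..1} f \<and>
     cubes_preserving f \<and>
     f ` {0..1} = {x. \<forall>i. 0 \<le> x $ i \<and> x $ i \<le> 1}"
proof -
  define N :: nat where "N = 2 ^ CARD('n)"
  obtain c r :: "nat \<Rightarrow> 'n \<Rightarrow> bool" and \<pi> b where
      c: "bij_betw c {..<N} UNIV" and \<pi>: "\<And>j. bij (\<pi> j)" and b: "b \<in> unit_cube"
    and first: "subcube_map (c 0) (r 0) (\<pi> 0) 0 = 0"
    and last: "subcube_map (c (N - 1)) (r (N - 1)) (\<pi> (N - 1)) b = b"
    and join: "\<And>j. Suc j < N \<Longrightarrow>
      subcube_map (c j) (r j) (\<pi> j) b = subcube_map (c (Suc j)) (r (Suc j)) (\<pi> (Suc j)) 0"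
    by (rule hilbert_subcube_maps[where 'n='n, folded N_def]) (rule that)
  let ?T = "\<lambda>j. subcube_map (c j) (r j) (\<pi> j)"
  have box: "unit_cube = (cbox 0 1 :: (real^'n) set)"
    by (auto simp: mem_box_cart)
  have "0 < N" "0 \<le> (1 / 2 :: real)" "1 / 2 < (1 :: real)"
    by (simp_all add: N_def)
  moreover have "dist (?T j x) (?T j y) \<le> 1 / 2 * dist x y" if "j < N" for j x y
    by (simp add: dist_subcube_map[OF \<pi>])
  moreover have "compact (unit_cube :: (real^'n) set)" "convex (unit_cube :: (real^'n) set)"
    unfolding box by (rule compact_cbox convex_box)+
  moreover have "unit_cube = (\<Union>j<N. ?T j ` unit_cube)"
    by (rule subcube_maps_cover[symmetric]) (use c \<pi> in \<open>auto simp: bij_betw_def\<close>)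
  moreover have "0 \<in> (unit_cube :: (real^'n) set)"
    by simp
  ultimately obtain f :: "real \<Rightarrow> real^'n" where f:
      "continuous_on {0..1} f" "f ` {0..1} = unit_cube"
      "\<And>j u. j < N \<Longrightarrow> u \<in> {0..1} \<Longrightarrow> f ((real j + u) / real N) = ?T j (f u)"
    by (rule self_similar_curve[of N "1 / 2" ?T unit_cube 0 b, OF _ _ _ _ _ _ _ _ b first last join])
      (assumption, assumption, rule that)
  have "cubes_preserving f"
    by (rule self_similar_curve_cubes_preserving
        [OF c[unfolded N_def] \<pi> equalityD1[OF f(2)] f(3)[unfolded N_def]])
  with f(1,2) show ?thesis by (intro exI[of _ f] conjI)
qed

end
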